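(* Let $N,d\ge 1$ be integers, $\gamma>0$, $h>0$, $\bar\psi\in\mathbb{R}^d$, and let $P:\mathbb{R}^d\times\mathbb{R}^d\to\mathbb{R}$ be continuously differentiable with $P(0,0)=0$ and $\|P\|_\infty:=\sup|P|<\infty$. Then the optimal control problem $Q(t_0,T,h,N,\psi^0)$ is cheaply controllable with $\varepsilon_0=0$, $\alpha(x)=\frac{\gamma}{2N}x^2$ and $S=0$. That is, there exists a constant $C_0>0$ (possibly depending on $h$) such that for all initial times $t_0\in\mathbb{R}$, all initial states $\psi^0\in\mathbb{R}^{N\times d}$ and all terminal times $T>t_0$ with $(T-t_0)/h\in\mathbb{N}$, $$v_N^{(h,t_0,T)}(\psi^0)\ \le\ C_0\,\frac{\gamma}{2N}\,\|\psi^0-\psi^{(\sigma)}\|_N^2 .$$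
   Context: For $x=(x_1,\dots,x_N)\in\mathbb{R}^{N\times d}$ put $\|x\|_N^2:=\sum_{k=1}^N\|x_k\|^2$ with $\|\cdot\|$ the Euclidean norm on $\mathbb{R}^d$; $\bar\psi\in\mathbb{R}^d$ is identified with $(\bar\psi,\dots,\bar\psi)\in\mathbb{R}^{N\times d}$ inside $\|\cdot\|_N$. With $M=(T-t_0)/h$, the dynamics with initial state $\psi^0$ and controls $u=(u^0,\dots,u^{M-1})$, $u^i\in\mathbb{R}^{N\times d}$, are $$\psi_k^{i+1}=\psi_k^i+h\Big(\frac1N\sum_{l=1}^N P(\psi_k^i,\psi_l^i)(\psi_l^i-\psi_k^i)+u_k^i\Big),\quad i=0,\dots,M-1,\ k=1,\dots,N .$$ Problem $Q(t_0,T,h,N,\psi^0)$: minimize over $u$, subject to the dynamics, the cost $$J_N^{(h,t_0,T)}(\psi,u)=\sum_{i=0}^{M-1}\frac hN\left(\|\psi^i-\bar\psi\|_N^2+\gamma\|u^i\|_N^2\right),$$ and $v_N^{(h,t_0,T)}(\psi^0)$ denotes its optimal (minimal) value. $(\psi^{(\sigma)},u^{(\sigma)})$ is the optimal solution of the static problem of minimizing $\frac1N(\|\psi^{(\sigma)}-\bar\psi\|_N^2+\gamma\|u^{(\sigma)}\|_N^2)$ subject to $\frac1N\sum_{l=1}^N\big(P(\psi_k^{(\sigma)},\psi_l^{(\sigma)})(\psi_l^{(\sigma)}-\psi_k^{(\sigma)})+u_k^{(\sigma)}\big)=0$ for all $k$; it is given by $\psi^{(\sigma)}_k=\bar\psi$,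 $u^{(\sigma)}_k=0$ for all $k$. The cheap control condition (with data $\alpha,S,\varepsilon_0\ge0$) reads: there is $C_0>0$ such that for all $t_0,\psi^0,T>t_0$ one has $v_N^{(h,t_0,T)}(\psi^0)\le C_0\,\alpha(\|\psi^0-\psi^{(\sigma)}\|_N)+\varepsilon_0+S(\psi^M)-S(\psi^0)$, where $\psi^M$ is the optimal state at time $T$. *)

theory Defs
  imports "HOL-Analysis.Analysis"
begin

text \<open>
  States and controls of the N-agent system in dimension d are elements of
  \<open>real ^ 'd ^ 'n\<close>, with \<open>N = CARD('n)\<close> and \<open>d = CARD('d)\<close>. The library norm of this type is
  \<open>norm x = sqrt (\<Sum>k\<in>UNIV. (norm (x $ k))\<^sup>2)\<close>, i.e. the norm \<open>\<parallel>x\<parallel>\<^sub>N\<close>.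
\<close>

definition C1_function :: "('a::real_normed_vector \<Rightarrow> 'b::real_normed_vector) \<Rightarrow> bool" where
  "C1_function f \<longleftrightarrow>
     (\<exists>f' :: 'a \<Rightarrow> 'a \<Rightarrow>\<^sub>L 'b.
        (\<forall>z. (f has_derivative blinfun_apply (f' z)) (at z)) \<and> continuous_on UNIV f')"

definition consensus :: "real ^ 'd \<Rightarrow> real ^ 'd ^ 'n" where
  "consensus x = (\<chi> k. x)"

text \<open>The floor is only a conversion to \<open>nat\<close>: the horizon is used for \<open>(T - t0) / h \<in> \<nat>\<close>.\<close>

definition horizon :: "real \<Rightarrow> real \<Rightarrow> real \<Rightarrow> nat" where
  "horizon h t0 T = nat \<lfloor>(T - t0) / h\<rfloor>"

text \<open>
  Trajectories and controls are sequences over all of \<open>nat\<close>; only \<open>\<psi> 0, \<dots>, \<psi> M\<close> and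
  \<open>u 0, \<dots>, u (M - 1)\<close> are constrained by the dynamics or enter the cost.
\<close>

definition admissible ::
  "((real ^ 'd) \<times> (real ^ 'd) \<Rightarrow> real) \<Rightarrow> real \<Rightarrow> real \<Rightarrow> real \<Rightarrow> real ^ 'd ^ 'n
    \<Rightarrow> (nat \<Rightarrow> real ^ 'd ^ 'n) \<Rightarrow> (nat \<Rightarrow> real ^ 'd ^ 'n) \<Rightarrow> bool" where
  "admissible P h t0 T \<psi>0 \<psi> u \<longleftrightarrow>
     \<psi> 0 = \<psi>0 \<and>
     (\<forall>i < horizon h t0 T. \<forall>k.
        \<psi> (Suc i) $ k =
          \<psi> i $ k + h *\<^sub>R ((1 / real CARD('n)) *\<^sub>R
                              (\<Sum>l\<in>UNIV. P (\<psi> i $ k, \<psi> i $ l) *\<^sub>R (\<psi> i $ l - \<psi> i $ k))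
                            + u i $ k))"

definition cost ::
  "real \<Rightarrow> real ^ 'd \<Rightarrow> real \<Rightarrow> real \<Rightarrow> real
    \<Rightarrow> (nat \<Rightarrow> real ^ 'd ^ 'n) \<Rightarrow> (nat \<Rightarrow> real ^ 'd ^ 'n) \<Rightarrow> real" where
  "cost \<gamma> \<psi>bar h t0 T \<psi> u =
     (\<Sum>i < horizon h t0 T. h / real CARD('n) *
        ((norm (\<psi> i - consensus \<psi>bar))\<^sup>2 + \<gamma> * (norm (u i))\<^sup>2))"

definition optimal ::
  "((real ^ 'd) \<times> (real ^ 'd) \<Rightarrow> real) \<Rightarrow> real \<Rightarrow> real ^ 'd \<Rightarrow> real \<Rightarrow> real \<Rightarrow> real
    \<Rightarrow> real ^ 'd ^ 'n \<Rightarrow> (nat \<Rightarrow> real ^ 'd ^ 'n) \<Rightarrow> (nat \<Rightarrow> real ^ 'd ^ 'n) \<Rightarrow> bool" where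
  "optimal P \<gamma> \<psi>bar h t0 T \<psi>0 \<psi> u \<longleftrightarrow>
     admissible P h t0 T \<psi>0 \<psi> u \<and>
     (\<forall>\<psi>' u'. admissible P h t0 T \<psi>0 \<psi>' u' \<longrightarrow>
        cost \<gamma> \<psi>bar h t0 T \<psi> u \<le> cost \<gamma> \<psi>bar h t0 T \<psi>' u')"

definition optimal_value ::
  "((real ^ 'd) \<times> (real ^ 'd) \<Rightarrow> real) \<Rightarrow> real \<Rightarrow> real ^ 'd \<Rightarrow> real \<Rightarrow> real \<Rightarrow> real
    \<Rightarrow> real ^ 'd ^ 'n \<Rightarrow> real" where
  "optimal_value P \<gamma> \<psi>bar h t0 T \<psi>0 =
     Inf {cost \<gamma> \<psi>bar h t0 T \<psi> u | \<psi> u. admissible P h t0 T \<psi>0 \<psi> u}"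

definition static_admissible ::
  "((real ^ 'd) \<times> (real ^ 'd) \<Rightarrow> real) \<Rightarrow> real ^ 'd ^ 'n \<Rightarrow> real ^ 'd ^ 'n \<Rightarrow> bool" where
  "static_admissible P \<psi> u \<longleftrightarrow>
     (\<forall>k. (1 / real CARD('n)) *\<^sub>R
            (\<Sum>l\<in>UNIV. P (\<psi> $ k, \<psi> $ l) *\<^sub>R (\<psi> $ l - \<psi> $ k) + u $ k) = 0)"

definition static_cost ::
  "real \<Rightarrow> real ^ 'd \<Rightarrow> real ^ 'd ^ 'n \<Rightarrow> real ^ 'd ^ 'n \<Rightarrow> real" where
  "static_cost \<gamma> \<psi>bar \<psi> u =
     1 / real CARD('n) * ((norm (\<psi> - consensus \<psi>bar))\<^sup>2 + \<gamma> * (norm u)\<^sup>2)"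

definition static_optimal ::
  "((real ^ 'd) \<times> (real ^ 'd) \<Rightarrow> real) \<Rightarrow> real \<Rightarrow> real ^ 'd
    \<Rightarrow> real ^ 'd ^ 'n \<Rightarrow> real ^ 'd ^ 'n \<Rightarrow> bool" where
  "static_optimal P \<gamma> \<psi>bar \<psi> u \<longleftrightarrow>
     static_admissible P \<psi> u \<and>
     (\<forall>(\<psi>' :: real ^ 'd ^ 'n) u'. static_admissible P \<psi>' u' \<longrightarrow>
        static_cost \<gamma> \<psi>bar \<psi> u \<le> static_cost \<gamma> \<psi>bar \<psi>' u')"

lemma static_optimal_iff:
  fixes \<gamma> :: real and \<psi> u :: "real ^ 'd ^ 'n"
  assumes "\<gamma> > 0"
  shows "static_optimal P \<gamma> \<psi>bar \<psi> u \<longleftrightarrow> \<psi> = consensus \<psi>bar \<and> u = 0"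
proof -
  have adm: "static_admissible P (consensus \<psi>bar :: real ^ 'd ^ 'n) 0"
    by (simp add: static_admissible_def consensus_def)
  have zero: "static_cost \<gamma> \<psi>bar (consensus \<psi>bar :: real ^ 'd ^ 'n) 0 = 0"
    by (simp add: static_cost_def)
  have nonneg: "static_cost \<gamma> \<psi>bar \<psi>' u' \<ge> 0" for \<psi>' u' :: "real ^ 'd ^ 'n"
    using assms by (simp add: static_cost_def)
  show ?thesis
  proof
    assume "static_optimal P \<gamma> \<psi>bar \<psi> u"
    then have "static_cost \<gamma> \<psi>bar \<psi> u \<le> 0"
      using adm zero unfolding static_optimal_def by metis
    then have "(norm (\<psi> - consensus \<psi>bar))\<^sup>2 + \<gamma> * (norm u)\<^sup>2 \<le> 0"
      by (simp add: static_cost_def divide_le_0_iff)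
    moreover have "(norm (\<psi> - consensus \<psi>bar))\<^sup>2 \<ge> 0" "\<gamma> * (norm u)\<^sup>2 \<ge> 0"
      using assms by simp_all
    ultimately have "(norm (\<psi> - consensus \<psi>bar))\<^sup>2 = 0" "\<gamma> * (norm u)\<^sup>2 = 0"
      by linarith+
    then show "\<psi> = consensus \<psi>bar \<and> u = 0"
      using assms by simp
  next
    assume "\<psi> = consensus \<psi>bar \<and> u = 0"
    then show "static_optimal P \<gamma> \<psi>bar \<psi> u"
      using adm zero nonneg by (simp add: static_optimal_def)
  qed
qed

text \<open>
  The condition refers to the optimal state at time \<open>T\<close>. An optimal solution is therefore required
  to exist, and since it need not be unique the estimate is required for each one. As optimal
  solutions exist, the infimum \<open>optimal_value\<close> is the minimal value of the cost.
\<close>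

definition cheaply_controllable ::
  "((real ^ 'd) \<times> (real ^ 'd) \<Rightarrow> real) \<Rightarrow> real \<Rightarrow> real ^ 'd \<Rightarrow> real \<Rightarrow> real ^ 'd ^ 'n
    \<Rightarrow> (real \<Rightarrow> real) \<Rightarrow> (real ^ 'd ^ 'n \<Rightarrow> real) \<Rightarrow> real \<Rightarrow> bool" where
  "cheaply_controllable P \<gamma> \<psi>bar h \<psi>\<sigma> \<alpha> S \<epsilon>0 \<longleftrightarrow>
     (\<forall>r \<ge> 0. \<alpha> r \<ge> 0) \<and> (\<forall>x. S x \<ge> 0) \<and> \<epsilon>0 \<ge> 0 \<and>
     (\<exists>C0 > 0. \<forall>t0 \<psi>0 T. t0 < T \<and> (T - t0) / h \<in> \<nat> \<longrightarrow>
        (\<exists>\<psi> u. optimal P \<gamma> \<psi>bar h t0 T \<psi>0 \<psi> u) \<and>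
        (\<forall>\<psi> u. optimal P \<gamma> \<psi>bar h t0 T \<psi>0 \<psi> u \<longrightarrow>
           optimal_value P \<gamma> \<psi>bar h t0 T \<psi>0
             \<le> C0 * \<alpha> (norm (\<psi>0 - \<psi>\<sigma>)) + \<epsilon>0 + S (\<psi> (horizon h t0 T)) - S \<psi>0))"

end

theory Submission
  imports Defs
begin

text \<open>
  Since the control enters every component of the dynamics additively, the consensus state can be
  reached in one step, and it is kept with zero control. Boundedness of \<open>P\<close> makes the control of
  this one step at most a constant times the distance to consensus, so its cost is quadratic in
  that distance. An optimal control exists because the cost is continuous and coercive in the
  controls, so that a minimum over a compact product of balls is a global one.
\<close>

text \<open>The interaction terms of all agents as one vector, so that the dynamics become an
  explicit Euler step in the full state space.\<close>

definition drift :: "((real ^ 'd) \<times> (real ^ 'd) \<Rightarrow> real) \<Rightarrow> real ^ 'd ^ 'n \<Rightarrow> real ^ 'd ^ 'n" where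
  "drift P x = (\<chi> k. (1 / real CARD('n)) *\<^sub>R (\<Sum>l\<in>UNIV. P (x $ k, x $ l) *\<^sub>R (x $ l - x $ k)))"

lemma admissible_iff:
  fixes \<psi>0 :: "real ^ 'd ^ 'n"
  shows "admissible P h t0 T \<psi>0 \<psi> u \<longleftrightarrow>
    \<psi> 0 = \<psi>0 \<and> (\<forall>i < horizon h t0 T. \<psi> (Suc i) = \<psi> i + h *\<^sub>R (drift P (\<psi> i) + u i))"
  by (simp add: admissible_def drift_def vec_eq_iff)

lemma drift_consensus [simp]: "drift P (consensus x) = 0"
  by (simp add: drift_def consensus_def vec_eq_iff)

lemma continuous_on_drift:
  fixes f :: "'a::topological_space \<Rightarrow> real ^ 'd ^ 'n"
  assumes "continuous_on UNIV P" "continuous_on A f"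
  shows "continuous_on A (\<lambda>x. drift P (f x))"
  unfolding drift_def
  by (intro continuous_intros continuous_on_compose2[OF assms(1)] assms(2)) auto

text \<open>Every agent lies within \<open>norm (x - consensus y)\<close> of \<open>y\<close>, so
  two agents differ by at most twice that, whatever \<open>y\<close> is; averaging over
  \<open>l\<close> keeps the bound for each component.\<close>

lemma norm_drift_le:
  fixes x :: "real ^ 'd ^ 'n"
  assumes P: "\<And>z. \<bar>P z\<bar> \<le> B"
  shows "norm (drift P x) \<le> real CARD('n) * (2 * B * norm (x - consensus y))"
proof -
  let ?r = "norm (x - consensus y)"
  have B: "0 \<le> B" using P[of undefined] by linarith
  have near: "norm (x $ k - y) \<le> ?r" for k
    using Finite_Cartesian_Product.norm_nth_le[of "x - consensus y" k] by (simp add: consensus_def)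
  have diff: "norm (x $ l - x $ k) \<le> 2 * ?r" for k l
    using norm_triangle_ineq4[of "x $ l - y" "x $ k - y"] near[of k] near[of l] by simp
  have "norm (drift P x $ k) \<le> 2 * B * ?r" for k
  proof -
    have "norm (\<Sum>l\<in>UNIV. P (x $ k, x $ l) *\<^sub>R (x $ l - x $ k)) \<le> (\<Sum>l\<in>(UNIV::'n set). B * (2 * ?r))"
      by (intro order_trans[OF norm_sum] sum_mono) (auto intro!: mult_mono P diff B)
    then show ?thesis
      by (simp add: drift_def field_simps)
  qed
  \<comment> \<open>The Euclidean norm is at most the sum of the component norms. This costs the
    factor \<open>CARD('n)\<close>, which is harmless because only some constant is wanted.\<close>
  then have "(\<Sum>k\<in>UNIV. norm (drift P x $ k)) \<le> (\<Sum>k\<in>(UNIV::'n set). 2 * B * ?r)"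
    by (intro sum_mono)
  then show ?thesis
    using L2_set_le_sum[of UNIV "\<lambda>k. norm (drift P x $ k)"] by (simp add: norm_vec_def)
qed

text \<open>Eliminates the state: the problem becomes a minimization over control sequences
  alone.\<close>

primrec trajectory ::
  "((real ^ 'd) \<times> (real ^ 'd) \<Rightarrow> real) \<Rightarrow> real \<Rightarrow> real ^ 'd ^ 'n
    \<Rightarrow> (nat \<Rightarrow> real ^ 'd ^ 'n) \<Rightarrow> nat \<Rightarrow> real ^ 'd ^ 'n" where
  "trajectory P h x u 0 = x"
| "trajectory P h x u (Suc i) =
     trajectory P h x u i + h *\<^sub>R (drift P (trajectory P h x u i) + u i)"

lemma admissible_trajectory: "admissible P h t0 T x (trajectory P h x u) u"
  by (simp add: admissible_iff)

text \<open>The recursion up to index \<open>i\<close> reads only the controls before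
  \<open>i\<close>. The second control \<open>v\<close> leaves room for changing \<open>u\<close>
  from the horizon on.\<close>

lemma admissible_imp_trajectory:
  assumes "admissible P h t0 T x \<psi> u" "\<And>j. j < i \<Longrightarrow> v j = u j" "i \<le> horizon h t0 T"
  shows "\<psi> i = trajectory P h x v i"
  using assms(2,3)
proof (induction i)
  case 0
  then show ?case using assms(1) by (simp add: admissible_iff)
next
  case (Suc i)
  then show ?case using assms(1) by (simp add: admissible_iff)
qed

lemma cost_eq_trajectory:
  assumes "admissible P h t0 T x \<psi> u" "\<And>i. i < horizon h t0 T \<Longrightarrow> v i = u i"
  shows "cost \<gamma> y h t0 T \<psi> u = cost \<gamma> y h t0 T (trajectory P h x v) v"
  unfolding cost_def
proof (rule sum.cong)
  fix i assume "i \<in> {..<horizon h t0 T}"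
  then show "h / real CARD('b) * ((norm (\<psi> i - consensus y))\<^sup>2 + \<gamma> * (norm (u i))\<^sup>2) =
    h / real CARD('b) * ((norm (trajectory P h x v i - consensus y))\<^sup>2 + \<gamma> * (norm (v i))\<^sup>2)"
    using admissible_imp_trajectory[OF assms(1), of i v] assms(2) by simp
qed simp

text \<open>Sequences carry the product topology, in which each coordinate is continuous, and a
  state is built from finitely many coordinates by continuous maps.\<close>

lemma continuous_on_trajectory:
  assumes "continuous_on UNIV P"
  shows "continuous_on UNIV (\<lambda>u. trajectory P h x u i)"
proof (induction i)
  case (Suc i)
  then show ?case
    by (auto intro!: continuous_intros continuous_on_drift assms continuous_on_product_coordinates)
qed simp

lemma continuous_on_cost_trajectory:
  assumes "continuous_on UNIV P"
  shows "continuous_on UNIV (\<lambda>u. cost \<gamma> y h t0 T (trajectory P h x u) u)"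
  unfolding cost_def
  by (intro continuous_intros continuous_on_trajectory assms continuous_on_product_coordinates)

lemma cost_nonneg:
  assumes "h > 0" "\<gamma> > 0"
  shows "cost \<gamma> y h t0 T \<psi> u \<ge> 0"
  using assms by (simp add: cost_def sum_nonneg)

lemma optimal_exists:
  fixes x :: "real ^ 'd ^ 'n"
  assumes \<gamma>: "\<gamma> > 0" and h: "h > 0" and P: "continuous_on UNIV P"
  shows "\<exists>\<psi> u. optimal P \<gamma> y h t0 T x \<psi> u"
proof -
  let ?J = "\<lambda>u. cost \<gamma> y h t0 T (trajectory P h x u) u"
  let ?N = "real CARD('n)"
  \<comment> \<open>\<open>R\<close> is chosen so that a single control of norm \<open>R\<close>
    already costs as much as the whole zero control: \<open>h / ?N * (\<gamma> * R\<^sup>2)\<close>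
    equals \<open>?J (\<lambda>_. 0)\<close>.\<close>
  define R where "R = sqrt (?N / (h * \<gamma>) * ?J (\<lambda>_. 0))"
  let ?K = "UNIV \<rightarrow>\<^sub>E cball 0 R :: (nat \<Rightarrow> real ^ 'd ^ 'n) set"
  have J0: "?J (\<lambda>_. 0) \<ge> 0"
    by (rule cost_nonneg[OF h \<gamma>])
  have R: "R \<ge> 0" "R\<^sup>2 = ?N / (h * \<gamma>) * ?J (\<lambda>_. 0)"
    using J0 \<gamma> h by (simp_all add: R_def)
  \<comment> \<open>Tychonoff's theorem, as the controls are infinite sequences; each factor is a
    closed ball in finite dimension.\<close>
  have "compactin (product_topology (\<lambda>_. euclidean) UNIV) ?K"
    by (simp add: compactin_PiE)
  then have "compact ?K"
    by (simp add: euclidean_product_topology)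
  moreover have zero: "(\<lambda>_. 0) \<in> ?K"
    using R by auto
  moreover have "continuous_on ?K ?J"
    by (rule continuous_on_subset[OF continuous_on_cost_trajectory[OF P] subset_UNIV])
  ultimately have "\<exists>u\<in>?K. \<forall>v\<in>?K. ?J u \<le> ?J v"
    by (intro continuous_attains_inf) auto
  then obtain u where min: "\<And>v. v \<in> ?K \<Longrightarrow> ?J u \<le> ?J v"
    by blast
  have "?J u \<le> cost \<gamma> y h t0 T \<psi> v" if adm: "admissible P h t0 T x \<psi> v" for \<psi> v
  proof (cases "\<forall>i < horizon h t0 T. norm (v i) \<le> R")
    case True
    \<comment> \<open>Controls from the horizon on are unconstrained and may leave the balls;
      setting them to zero does not change the cost.\<close>
    define w where "w i = (if i < horizon h t0 T then v i else 0)" for i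
    have "w \<in> ?K"
      using True R by (auto simp: w_def)
    moreover have "cost \<gamma> y h t0 T \<psi> v = ?J w"
      by (intro cost_eq_trajectory adm) (simp add: w_def)
    ultimately show ?thesis
      using min by simp
  next
    case False
    then obtain i where i: "i < horizon h t0 T" "norm (v i) > R" by fastforce
    have "?J u \<le> ?J (\<lambda>_. 0)"
      using min zero by blast
    also have "\<dots> = h / ?N * (\<gamma> * R\<^sup>2)"
      using \<gamma> h by (simp add: R)
    also have "\<dots> \<le> h / ?N * ((norm (\<psi> i - consensus y))\<^sup>2 + \<gamma> * (norm (v i))\<^sup>2)"
      using i R \<gamma> h by (intro mult_left_mono add_increasing power_mono) auto
    also have "\<dots> \<le> cost \<gamma> y h t0 T \<psi> v"
      unfolding cost_def using i \<gamma> h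
      by (intro member_le_sum[of i "{..<horizon h t0 T}"]) auto
    finally show ?thesis .
  qed
  then show ?thesis
    using admissible_trajectory unfolding optimal_def by blast
qed

lemma optimal_value_le_cost:
  assumes "\<gamma> > 0" "h > 0" "admissible P h t0 T x \<psi> u"
  shows "optimal_value P \<gamma> y h t0 T x \<le> cost \<gamma> y h t0 T \<psi> u"
  unfolding optimal_value_def
proof (rule cInf_lower)
  show "bdd_below {cost \<gamma> y h t0 T \<psi> u |\<psi> u. admissible P h t0 T x \<psi> u}"
    using cost_nonneg[OF assms(2,1)] by (auto intro!: bdd_belowI[of _ 0])
qed (use assms(3) in blast)

text \<open>Compare with the control that jumps to consensus in one step. Only the initial stage has
  a cost, so the constant does not depend on the horizon; \<open>1 / h\<close> stems from the jump,
  the other summand from cancelling the drift.\<close>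

lemma optimal_value_le:
  fixes x :: "real ^ 'd ^ 'n"
  assumes \<gamma>: "\<gamma> > 0" and h: "h > 0" and P: "\<And>z. \<bar>P z\<bar> \<le> B"
  shows "optimal_value P \<gamma> y h t0 T x \<le>
    h / real CARD('n) * (1 + \<gamma> * (1 / h + real CARD('n) * (2 * B))\<^sup>2) * (norm (x - consensus y))\<^sup>2"
proof -
  let ?N = "real CARD('n)" and ?r = "norm (x - consensus y)"
  \<comment> \<open>The solution of
    \<open>consensus y = x + h *\<^sub>R (drift P x + v)\<close>.\<close>
  define v where "v = (1 / h) *\<^sub>R (consensus y - x) - drift P x"
  define \<psi> where "\<psi> i = (if i = 0 then x else consensus y)" for i :: nat
  define u where "u i = (if i = 0 then v else 0)" for i :: nat
  let ?c = "h / ?N * (?r\<^sup>2 + \<gamma> * (norm v)\<^sup>2)"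
  have adm: "admissible P h t0 T x \<psi> u"
    using h by (auto simp: admissible_iff \<psi>_def u_def v_def)
  have "norm v \<le> ?r / h + ?N * (2 * B * ?r)"
    unfolding v_def
    using norm_triangle_ineq4[of "(1 / h) *\<^sub>R (consensus y - x)" "drift P x"]
      norm_drift_le[where P = P, OF P, of x y] h by (simp add: norm_minus_commute)
  then have "norm v \<le> (1 / h + ?N * (2 * B)) * ?r"
    by (simp add: algebra_simps)
  then have "(norm v)\<^sup>2 \<le> (1 / h + ?N * (2 * B))\<^sup>2 * ?r\<^sup>2"
    by (metis norm_ge_zero power_mono power_mult_distrib)
  then have v: "?c \<le> h / ?N * (?r\<^sup>2 + \<gamma> * ((1 / h + ?N * (2 * B))\<^sup>2 * ?r\<^sup>2))"
    using \<gamma> h by (intro mult_left_mono add_left_mono) auto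
  have "cost \<gamma> y h t0 T \<psi> u = (\<Sum>i<horizon h t0 T. if i = 0 then ?c else 0)"
    unfolding cost_def by (intro sum.cong) (auto simp: \<psi>_def u_def)
  \<comment> \<open>An inequality, since the sum is empty when the horizon is 0.\<close>
  also have "\<dots> \<le> ?c"
    using \<gamma> h by (simp add: sum.delta)
  finally have "optimal_value P \<gamma> y h t0 T x \<le> ?c"
    using optimal_value_le_cost[OF \<gamma> h adm, of y] by linarith
  with v show ?thesis
    by (simp add: algebra_simps)
qed

theorem lemma3p2:
  fixes P :: "(real ^ 'd) \<times> (real ^ 'd) \<Rightarrow> real"
    and \<gamma> h :: real
    and \<psi>bar :: "real ^ 'd"
    and \<psi>\<sigma> u\<sigma> :: "real ^ 'd ^ 'n"
  assumes "\<gamma> > 0"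
    and "h > 0"
    and "C1_function P"
    and "P (0, 0) = 0"
    and "bdd_above (range (\<lambda>z. \<bar>P z\<bar>))"
    and "static_optimal P \<gamma> \<psi>bar \<psi>\<sigma> u\<sigma>"
  shows "cheaply_controllable P \<gamma> \<psi>bar h \<psi>\<sigma>
           (\<lambda>x. \<gamma> / (2 * real CARD('n)) * x\<^sup>2) (\<lambda>_. 0) 0 \<and>
         (\<exists>C0 > 0. \<forall>t0 \<psi>0 T. t0 < T \<and> (T - t0) / h \<in> \<nat> \<longrightarrow>
            optimal_value P \<gamma> \<psi>bar h t0 T \<psi>0
              \<le> C0 * (\<gamma> / (2 * real CARD('n))) * (norm (\<psi>0 - \<psi>\<sigma>))\<^sup>2)"
proof -
  note \<gamma> = assms(1) and h = assms(2)
  have \<psi>\<sigma>: "\<psi>\<sigma> = consensus \<psi>bar"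
    using assms(6) static_optimal_iff[OF \<gamma>] by blast
  have P: "continuous_on UNIV P"
    using assms(3) unfolding C1_function_def
    by (metis continuous_at_imp_continuous_on has_derivative_continuous)
  obtain B where B: "\<And>z. \<bar>P z\<bar> \<le> B"
    using assms(5) by (auto simp: bdd_above_def)
  define K where "K = 1 + \<gamma> * (1 / h + real CARD('n) * (2 * B))\<^sup>2"
  have K: "K > 0"
    using \<gamma> by (simp add: K_def add_pos_nonneg)
  \<comment> \<open>Cancels the factor \<open>\<gamma> / 2\<close> of \<alpha>, so that
    \<open>h / N * K\<close> remains with \<open>N = CARD('n)\<close>. It depends on
    \<open>h\<close>, but not on the times or the initial state.\<close>
  define C0 where "C0 = 2 * h * K / \<gamma>"
  have C0: "C0 > 0"
    using \<gamma> h K by (simp add: C0_def)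
  have "C0 * (\<gamma> / (2 * real CARD('n))) = h / real CARD('n) * K"
    using \<gamma> by (simp add: C0_def)
  then have bound: "optimal_value P \<gamma> \<psi>bar h t0 T \<psi>0
      \<le> C0 * (\<gamma> / (2 * real CARD('n))) * (norm (\<psi>0 - \<psi>\<sigma>))\<^sup>2" for t0 T and \<psi>0 :: "real ^ 'd ^ 'n"
    using optimal_value_le[where P = P, OF \<gamma> h B, of \<psi>bar t0 T \<psi>0] by (simp add: K_def \<psi>\<sigma>)
  have "cheaply_controllable P \<gamma> \<psi>bar h \<psi>\<sigma> (\<lambda>x. \<gamma> / (2 * real CARD('n)) * x\<^sup>2) (\<lambda>_. 0) 0"
    unfolding cheaply_controllable_def
  proof (intro conjI exI[of _ C0] allI impI)
    show "\<exists>\<psi> u. optimal P \<gamma> \<psi>bar h t0 T \<psi>0 \<psi> u" for t0 T \<psi>0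
      by (rule optimal_exists[OF \<gamma> h P])
  qed (use \<gamma> C0 bound in \<open>auto simp: mult.assoc\<close>)
  with C0 bound show ?thesis by blast
qed

end
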